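(* For any integer $k>0$ there exists a polynomial $p\in\mathbb{C}[z_1,z_2]$ of degree $2\lceil \frac{k}{4}\rceil+2$ such that $\mathcal{I}(p)^{\mathsf c}$ consists of exactly $k$ strictly convex bounded components.
   Context: The imaginary projection of $p\in\mathbb{C}[z_1,z_2]$ is $\mathcal{I}(p)=\{(\operatorname{Im} z_1,\operatorname{Im} z_2) : p(z_1,z_2)=0,\ (z_1,z_2)\in\mathbb{C}^2\}\subseteq\mathbb{R}^2$; $\mathcal{I}(p)^{\mathsf c}$ is its complement in $\mathbb{R}^2$; components are connected components. *)

theory Defs
  imports "HOL-Analysis.Analysis" "HOL-Computational_Algebra.Polynomial"
begin

text \<open>
  The ring \<open>\<complex>[z\<^sub>1, z\<^sub>2]\<close> is represented as \<open>\<complex>[z\<^sub>1][z\<^sub>2]\<close>, that is, by the type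
  \<^typ>\<open>complex poly poly\<close>: the coefficient of the monomial \<open>z\<^sub>1\<^sup>i z\<^sub>2\<^sup>j\<close> in \<open>p\<close> is
  \<open>coeff (coeff p j) i\<close>.
\<close>

definition eval2 :: "complex poly poly \<Rightarrow> complex \<Rightarrow> complex \<Rightarrow> complex" where
  "eval2 p z1 z2 = poly (poly p [:z2:]) z1"

lemma eval2_altdef:
  "eval2 p z1 z2 = (\<Sum>j\<le>degree p. \<Sum>i\<le>degree (coeff p j). coeff (coeff p j) i * z1 ^ i * z2 ^ j)"
  by (simp add: eval2_def poly_altdef[of p] poly_sum poly_altdef[of "coeff p _"]
      sum_distrib_right)

text \<open>The zero polynomial gets total degree 0, as for \<^const>\<open>degree\<close>.\<close>

definition total_degree :: "complex poly poly \<Rightarrow> nat" where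
  "total_degree p = Max (insert 0 {i + j | i j. coeff (coeff p j) i \<noteq> 0})"

lemma finite_total_degree_set:
  fixes p :: "complex poly poly"
  shows "finite {i + j | i j. coeff (coeff p j) i \<noteq> 0}"
proof (rule finite_subset)
  show "{i + j | i j. coeff (coeff p j) i \<noteq> 0}
      \<subseteq> (\<lambda>(i, j). i + j) ` (SIGMA i:{..Max ((\<lambda>j. degree (coeff p j)) ` {..degree p})}. {..degree p})"
  proof clarify
    fix i j assume *: "coeff (coeff p j) i \<noteq> 0"
    then have j: "j \<le> degree p" by (metis coeff_0 le_degree)
    from * have "i \<le> degree (coeff p j)" by (rule le_degree)
    also have "\<dots> \<le> Max ((\<lambda>j. degree (coeff p j)) ` {..degree p})"
      using j by (intro Max_ge) auto
    finally show "i + j \<in> (\<lambda>(i, j). i + j) `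
        (SIGMA i:{..Max ((\<lambda>j. degree (coeff p j)) ` {..degree p})}. {..degree p})"
      using j by force
  qed
qed auto

definition imaginary_projection :: "complex poly poly \<Rightarrow> (real \<times> real) set" where
  "imaginary_projection p = {(Im z1, Im z2) | z1 z2. eval2 p z1 z2 = 0}"

text \<open>
  Distinct points are taken from the closure, because the components considered here need not
  be closed: if they were taken from \<open>S\<close> itself, every open convex set would qualify.
  For a convex set, the condition says that the boundary contains no nondegenerate line segment.
  A single point is strictly convex.
\<close>

definition strictly_convex :: "'a::euclidean_space set \<Rightarrow> bool" where
  "strictly_convex S \<longleftrightarrow> convex S \<and>
     (\<forall>x\<in>closure S. \<forall>y\<in>closure S. x \<noteq> y \<longrightarrow> open_segment x y \<subseteq> interior S)"

end

theory Submission
  imports Defs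
begin

text \<open>
  The hyperbola \<open>(z\<^sub>1 - i a)\<^sup>2 - z\<^sub>2\<^sup>2 = (q + i p)\<^sup>2\<close> with \<open>p, q > 0\<close> has as complement of its imaginary
  projection the four convex regions cut out by the branches of
  \<open>(y\<^sub>1 - a)\<^sup>2 - y\<^sub>2\<^sup>2 = p\<^sup>2\<close> and \<open>(y\<^sub>1 - a)\<^sup>2 - y\<^sub>2\<^sup>2 = - q\<^sup>2\<close>, together with the isolated point \<open>(a, 0)\<close>.
  The conic \<open>z\<^sub>1\<^sup>2 + A\<^sup>2 z\<^sub>2\<^sup>2 = - A\<^sup>2\<close> leaves an open elliptic disc. Place \<open>\<lceil>k/4\<rceil>\<close> hyperbolas next to each
  other along the major axis of a flat ellipse: each of them
  adds four components (above, below, centre, and everything to its right).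
  The parameters of the last hyperbola are chosen such that it adds only \<open>(k - 1) mod 4\<close>
  components.
\<close>

section \<open>Strict convexity of elliptic discs and of hyperbola branches\<close>

lemma strictly_convex_singleton: "strictly_convex {x}"
  by (simp add: strictly_convex_def)

lemma strictly_convex_Int:
  assumes "strictly_convex S" "strictly_convex T"
  shows "strictly_convex (S \<inter> T)"
  unfolding strictly_convex_def
proof (intro conjI ballI impI)
  show "convex (S \<inter> T)"
    using assms by (simp add: strictly_convex_def convex_Int)
  fix x y assume xy: "x \<in> closure (S \<inter> T)" "y \<in> closure (S \<inter> T)" "x \<noteq> y"
  then have "x \<in> closure S" "y \<in> closure S" "x \<in> closure T" "y \<in> closure T"
    using closure_mono[of "S \<inter> T" S] closure_mono[of "S \<inter> T" T] by auto
  then show "open_segment x y \<subseteq> interior (S \<inter> T)"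
    using assms xy(3) by (simp add: strictly_convex_def)
qed

lemma strictly_convex_INT:
  assumes "finite I" "\<And>i. i \<in> I \<Longrightarrow> strictly_convex (S i)"
  shows "strictly_convex (\<Inter>i\<in>I. S i)"
  using assms
proof (induction rule: finite_induct)
  case empty
  then show ?case by (simp add: strictly_convex_def)
next
  case (insert i I)
  then show ?case by (simp add: strictly_convex_Int)
qed

text \<open>The closure of \<open>{x. g x < 0}\<close> lies in \<open>{x. g x \<le> 0}\<close>, so a
  condition on pairs of points with \<open>g \<le> 0\<close> covers all pairs from the
  closure.\<close>

lemma strictly_convex_sublevel:
  fixes g :: "'a::euclidean_space \<Rightarrow> real"
  assumes cont: "continuous_on UNIV g"
    and mid: "\<And>x y u. \<lbrakk>g x \<le> 0; g y \<le> 0; x \<noteq> y; 0 < u; u < 1\<rbrakk>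
                \<Longrightarrow> g ((1 - u) *\<^sub>R x + u *\<^sub>R y) < 0"
  shows "strictly_convex {x. g x < 0}"
proof -
  have "closed {x. g x \<le> 0}"
    by (intro closed_Collect_le cont continuous_intros)
  then have cl: "closure {x. g x < 0} \<subseteq> {x. g x \<le> 0}"
    by (intro closure_minimal) auto
  have op: "open {x. g x < 0}"
    by (intro open_Collect_less cont continuous_intros)
  have seg: "open_segment x y \<subseteq> {x. g x < 0}" if "g x \<le> 0" "g y \<le> 0" "x \<noteq> y" for x y
    using mid[OF that] by (auto simp: in_segment)
  have "convex {x. g x < 0}"
    unfolding convex_contains_open_segment
    using seg by (metis less_imp_le mem_Collect_eq open_segment_idem empty_subsetI)
  then show ?thesis
    unfolding strictly_convex_def interior_open[OF op] using cl seg by blast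
qed

text \<open>Strict Cauchy-Schwarz for the vectors (a, c) and (b, c), which are not parallel: by
  Lagrange's identity the squared product of their norms exceeds their squared inner product by (c
  (a - b))^2 > 0.\<close>

lemma sqrt_sum_squares_strict_convex:
  fixes a b c u :: real
  assumes "0 < c" "a \<noteq> b" "0 < u" "u < 1"
  shows "sqrt (((1 - u) * a + u * b)\<^sup>2 + c\<^sup>2)
       < (1 - u) * sqrt (a\<^sup>2 + c\<^sup>2) + u * sqrt (b\<^sup>2 + c\<^sup>2)"
proof -
  define r s where "r = sqrt (a\<^sup>2 + c\<^sup>2)" and "s = sqrt (b\<^sup>2 + c\<^sup>2)"
  have r: "r\<^sup>2 = a\<^sup>2 + c\<^sup>2" "0 \<le> r" and s: "s\<^sup>2 = b\<^sup>2 + c\<^sup>2" "0 \<le> s"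
    by (simp_all add: r_def s_def)
  have "(r * s)\<^sup>2 - (a * b + c\<^sup>2)\<^sup>2 = (c * (a - b))\<^sup>2"
    unfolding power_mult_distrib r(1) s(1) by (simp add: power2_eq_square algebra_simps)
  moreover have "(c * (a - b))\<^sup>2 > 0"
    using assms by simp
  ultimately have "(a * b + c\<^sup>2)\<^sup>2 < (r * s)\<^sup>2"
    by linarith
  then have "a * b + c\<^sup>2 < r * s"
    using r s by (intro power2_less_imp_less[of _ "r * s"]) auto
  then have "0 < 2 * (u * (1 - u)) * (r * s - (a * b + c\<^sup>2))"
    using assms by simp
  also have "\<dots> = ((1 - u)\<^sup>2 * r\<^sup>2 + u\<^sup>2 * s\<^sup>2 + 2 * u * (1 - u) * (r * s))
                 - (((1 - u) * a + u * b)\<^sup>2 + c\<^sup>2)"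
    unfolding r(1) s(1) by (simp add: power2_eq_square algebra_simps)
  also have "\<dots> = ((1 - u) * r + u * s)\<^sup>2 - (((1 - u) * a + u * b)\<^sup>2 + c\<^sup>2)"
    by (simp add: power2_eq_square algebra_simps)
  finally show ?thesis
    unfolding r_def[symmetric] s_def[symmetric] using r s assms
    by (intro real_less_lsqrt) auto
qed

text \<open>\<open>f\<close> and \<open>g\<close> play the role of affine coordinates. If
  \<open>f\<close> differs at the end points, the square root is strictly convex along the segment.
  If \<open>f\<close> agrees there, the square root is constant on the segment, but \<open>g\<close>
  differs and so exceeds the smaller of its end values in between.\<close>

lemma strictly_convex_hyperbola_branch:
  fixes f g :: "'a::euclidean_space \<Rightarrow> real"
  assumes cont: "continuous_on UNIV f" "continuous_on UNIV g"
    and f: "\<And>x y u. f ((1 - u) *\<^sub>R x + u *\<^sub>R y) = (1 - u) * f x + u * f y"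
    and g: "\<And>x y u. g ((1 - u) *\<^sub>R x + u *\<^sub>R y) = (1 - u) * g x + u * g y"
    and inj: "\<And>x y. f x = f y \<Longrightarrow> g x = g y \<Longrightarrow> x = y"
    and "0 < c"
  shows "strictly_convex {x. sqrt ((f x)\<^sup>2 + c\<^sup>2) < g x}"
proof -
  have "strictly_convex {x. sqrt ((f x)\<^sup>2 + c\<^sup>2) - g x < 0}"
  proof (rule strictly_convex_sublevel)
    show "continuous_on UNIV (\<lambda>x. sqrt ((f x)\<^sup>2 + c\<^sup>2) - g x)"
      by (intro continuous_intros cont)
    fix x y :: 'a and u :: real
    assume *: "sqrt ((f x)\<^sup>2 + c\<^sup>2) - g x \<le> 0" "sqrt ((f y)\<^sup>2 + c\<^sup>2) - g y \<le> 0"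
      "x \<noteq> y" "0 < u" "u < 1"
    define w where "w = (1 - u) *\<^sub>R x + u *\<^sub>R y"
    have le: "(1 - u) * sqrt ((f x)\<^sup>2 + c\<^sup>2) \<le> (1 - u) * g x"
      "u * sqrt ((f y)\<^sup>2 + c\<^sup>2) \<le> u * g y"
      using * by (auto intro!: mult_left_mono)
    show "sqrt ((f w)\<^sup>2 + c\<^sup>2) - g w < 0"
    proof (cases "f x = f y")
      case True
      then have "g x \<noteq> g y" using inj * by blast
      moreover have fw: "f w = f x" unfolding w_def f True by (simp add: algebra_simps)
      moreover have "sqrt ((f x)\<^sup>2 + c\<^sup>2) \<le> min (g x) (g y)" using * True by auto
      moreover have "min (g x) (g y) < (1 - u) * g x + u * g y"
      proof (cases "g x < g y")
        case True
        then have "u * g x < u * g y" using * by simp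
        then show ?thesis using True by (simp add: algebra_simps)
      next
        case False
        then have "(1 - u) * g y < (1 - u) * g x" using * \<open>g x \<noteq> g y\<close> by simp
        then show ?thesis using False by (simp add: algebra_simps)
      qed
      moreover have "g w = (1 - u) * g x + u * g y" unfolding w_def by (rule g)
      ultimately show ?thesis unfolding fw by linarith
    next
      case False
      then show ?thesis
        using sqrt_sum_squares_strict_convex[OF \<open>0 < c\<close> False *(4,5)] le
        unfolding w_def f g by linarith
    qed
  qed
  then show ?thesis by simp
qed

text \<open>At a convex combination the quadratic function falls below the interpolated value by u
  (1 - u) times a positive definite form in the difference of the end points.\<close>

lemma strictly_convex_ellipse:
  fixes A :: real
  assumes "A \<noteq> 0"
  shows "strictly_convex {y::real \<times> real. (fst y)\<^sup>2 + A\<^sup>2 * (snd y)\<^sup>2 < A\<^sup>2}"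
proof -
  define g where "g y = (fst y)\<^sup>2 + A\<^sup>2 * (snd y)\<^sup>2 - A\<^sup>2" for y :: "real \<times> real"
  have "strictly_convex {y. g y < 0}"
  proof (rule strictly_convex_sublevel)
    show "continuous_on UNIV g"
      unfolding g_def by (intro continuous_intros)
    fix x y :: "real \<times> real" and u :: real
    assume *: "g x \<le> 0" "g y \<le> 0" "x \<noteq> y" "0 < u" "u < 1"
    have "0 < (fst x - fst y)\<^sup>2 + A\<^sup>2 * (snd x - snd y)\<^sup>2"
    proof (cases "fst x = fst y")
      case True
      then have "snd x \<noteq> snd y" using * by (simp add: prod_eq_iff)
      then show ?thesis using True assms by simp
    next
      case False
      then show ?thesis by (simp add: add_pos_nonneg)
    qed
    then have "0 < (u * (1 - u)) * ((fst x - fst y)\<^sup>2 + A\<^sup>2 * (snd x - snd y)\<^sup>2)"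
      using * by simp
    moreover have "(1 - u) * g x \<le> 0" "u * g y \<le> 0"
      using * by (simp_all add: mult_nonneg_nonpos)
    moreover have "g ((1 - u) *\<^sub>R x + u *\<^sub>R y) = (1 - u) * g x + u * g y
        - (u * (1 - u)) * ((fst x - fst y)\<^sup>2 + A\<^sup>2 * (snd x - snd y)\<^sup>2)"
      unfolding g_def by (simp add: power2_eq_square algebra_simps)
    ultimately show "g ((1 - u) *\<^sub>R x + u *\<^sub>R y) < 0" by linarith
  qed
  then show ?thesis by (simp add: g_def)
qed

section \<open>Connected components of a union of disjoint pieces\<close>

text \<open>The index of the piece containing a point is locally constant, hence constant on
  connected sets. Openness is relative to the union because the isolated centres of the hyperbolas
  are not open in the plane.\<close>

lemma components_disjoint_UN:
  fixes F :: "'b \<Rightarrow> 'a::topological_space set" and I :: "'b set"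
  defines "W \<equiv> \<Union>i\<in>I. F i"
  assumes conn: "\<And>i. i \<in> I \<Longrightarrow> connected (F i)"
    and op: "\<And>i. i \<in> I \<Longrightarrow> openin (top_of_set W) (F i)"
    and disj: "disjoint_family_on F I"
  shows "components W = F ` {i \<in> I. F i \<noteq> {}}"
    and "card (components W) = card {i \<in> I. F i \<noteq> {}}"
proof -
  define f where "f y = (THE i. i \<in> I \<and> y \<in> F i)" for y
  have f: "f y = i" if "i \<in> I" "y \<in> F i" for i y
    unfolding f_def using that disj by (intro the_equality) (auto simp: disjoint_family_on_def)
  have comp: "connected_component_set W x = F i" if i: "i \<in> I" "x \<in> F i" for i x
  proof
    let ?C = "connected_component_set W x"
    have sub: "?C \<subseteq> W" by (rule connected_component_subset)
    have "f constant_on ?C"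
    proof (rule locally_constant_imp_constant)
      fix a assume a: "a \<in> ?C"
      then obtain j where j: "j \<in> I" "a \<in> F j"
        using sub unfolding W_def by auto
      have "openin (top_of_set ?C) (?C \<inter> F j)"
        using op[OF j(1)] sub openin_subtopology_Int_subset
        by (metis inf.absorb_iff2 openin_imp_subset)
      then show "\<exists>T. openin (top_of_set ?C) T \<and> a \<in> T \<and> (\<forall>y\<in>T. f y = f a)"
        using a j f by (intro exI[of _ "?C \<inter> F j"]) auto
    qed simp
    moreover have "x \<in> W" using i by (auto simp: W_def)
    ultimately have "f y = i" if "y \<in> ?C" for y
      using that f[OF i] by (metis connected_component_refl constant_on_def mem_Collect_eq)
    then show "?C \<subseteq> F i"
      using sub f unfolding W_def by blast
    show "F i \<subseteq> ?C"
      by (rule connected_component_maximal) (use i conn in \<open>auto simp: W_def\<close>)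
  qed
  show eq: "components W = F ` {i \<in> I. F i \<noteq> {}}"
  proof
    show "components W \<subseteq> F ` {i \<in> I. F i \<noteq> {}}"
      using comp unfolding components_def W_def by fastforce
    show "F ` {i \<in> I. F i \<noteq> {}} \<subseteq> components W"
      using comp unfolding components_def W_def by fastforce
  qed
  have "inj_on F {i \<in> I. F i \<noteq> {}}"
  proof (rule inj_onI)
    fix i j assume ij: "i \<in> {i \<in> I. F i \<noteq> {}}" "j \<in> {i \<in> I. F i \<noteq> {}}" "F i = F j"
    then obtain y where "y \<in> F i" by blast
    then have "f y = i" "f y = j" using ij by (auto intro: f)
    then show "i = j" by (rule trans[OF sym])
  qed
  then show "card (components W) = card {i \<in> I. F i \<noteq> {}}"
    unfolding eq by (rule card_image)
qed

text \<open>
  By \<open>sep\<close>, the vector of indices of the sets \<open>R i x\<close> containing a given point has the shape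
  \<open>(4, \<dots>, 4, x, 0, \<dots>, 0)\<close>, so it is determined by its sum \<open>l\<close>; its \<open>i\<close>-th entry is
  \<open>min 4 (l - 4 * i)\<close> with truncated subtraction.
\<close>

lemma components_arrangement:
  fixes E :: "'a::euclidean_space set" and R :: "nat \<Rightarrow> nat \<Rightarrow> 'a set" and N :: nat
  defines "F \<equiv> \<lambda>l. E \<inter> (\<Inter>i\<le>N. R i (min 4 (l - 4 * i)))"
    and "W \<equiv> E \<inter> (\<Inter>i\<le>N. \<Union>x\<le>4. R i x)"
  assumes E: "strictly_convex E"
    and R: "\<And>i x. i \<le> N \<Longrightarrow> x \<le> 4 \<Longrightarrow> strictly_convex (R i x)"
    and op: "\<And>i x. i \<le> N \<Longrightarrow> x \<le> 4 \<Longrightarrow> openin (top_of_set (\<Union>x\<le>4. R i x)) (R i x)"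
    and disj: "\<And>i. i \<le> N \<Longrightarrow> disjoint_family_on (R i) {..4}"
    and sep: "\<And>i j x y. \<lbrakk>j < i; i \<le> N; 0 < x; x \<le> 4; y \<in> E; y \<in> R i x\<rbrakk> \<Longrightarrow> y \<in> R j 4"
  shows "C \<in> components W \<Longrightarrow> strictly_convex C"
    and "card (components W) = card {l. l \<le> 4 * N + 4 \<and> F l \<noteq> {}}"
proof -
  have W: "W = (\<Union>l\<in>{..4 * N + 4}. F l)"
  proof (intro equalityI subsetI)
    fix y assume "y \<in> W"
    then have y: "y \<in> E" "\<exists>x\<le>4. y \<in> R i x" if "i \<le> N" for i
      using that by (auto simp: W_def)
    have "y \<in> E" using y by blast
    define J where "J = {i. i \<le> N \<and> y \<notin> R i 0}"
    show "y \<in> (\<Union>l\<in>{..4 * N + 4}. F l)"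
    proof (cases "J = {}")
      case True
      then have "y \<in> F 0" using \<open>y \<in> E\<close> by (auto simp: F_def J_def)
      then show ?thesis by blast
    next
      case False
      have fin: "finite J" by (simp add: J_def)
      \<comment> \<open>The last index whose region 0 misses \<open>y\<close>: larger indices have
        entry 0, and by \<open>sep\<close> all smaller ones have entry 4.\<close>
      define i where "i = Max J"
      have i: "i \<le> N" "y \<notin> R i 0"
        using Max_in[OF fin False] by (auto simp: i_def J_def)
      then obtain x where x: "x \<le> 4" "y \<in> R i x" "0 < x"
        using y(2) by (metis not_gr_zero)
      have "y \<in> R j (min 4 (4 * i + x - 4 * j))" if "j \<le> N" for j
      proof (cases i j rule: linorder_cases)
        case less
        then have "j \<notin> J"
          using Max_ge[OF fin, of j] by (auto simp: i_def)
        then have "y \<in> R j 0"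
          using that by (simp add: J_def)
        moreover have "4 * i + x - 4 * j = 0" using less x by simp
        ultimately show ?thesis by simp
      next
        case equal
        then show ?thesis using x by simp
      next
        case greater
        then have "4 \<le> 4 * i + x - 4 * j" by simp
        then show ?thesis using sep[OF greater i(1) x(3,1) \<open>y \<in> E\<close> x(2)] by (simp add: min_def)
      qed
      then have "y \<in> F (4 * i + x)" using \<open>y \<in> E\<close> by (auto simp: F_def)
      then show ?thesis using i x by (intro UN_I[of "4 * i + x"]) auto
    qed
  next
    fix y assume "y \<in> (\<Union>l\<in>{..4 * N + 4}. F l)"
    then obtain l where l: "y \<in> F l" by blast
    have "\<exists>x\<le>4. y \<in> R i x" if "i \<le> N" for i
      using l that by (intro exI[of _ "min 4 (l - 4 * i)"]) (auto simp: F_def)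
    then show "y \<in> W" using l by (auto simp: W_def F_def)
  qed
  have sc: "strictly_convex (F l)" for l
    unfolding F_def by (intro strictly_convex_Int strictly_convex_INT E R) auto
  have opF: "openin (top_of_set W) (F l)" for l
  proof -
    have "\<exists>U. open U \<and> R i (min 4 (l - 4 * i)) = (\<Union>x\<le>4. R i x) \<inter> U" if "i \<le> N" for i
      using op[OF that, of "min 4 (l - 4 * i)"] by (auto simp: openin_open)
    then obtain U where U: "\<And>i. i \<le> N \<Longrightarrow> open (U i)"
      "\<And>i. i \<le> N \<Longrightarrow> R i (min 4 (l - 4 * i)) = (\<Union>x\<le>4. R i x) \<inter> U i"
      by metis
    have "F l = W \<inter> (\<Inter>i\<le>N. U i)"
      unfolding F_def W_def using U(2) by auto
    moreover have "open (\<Inter>i\<le>N. U i)"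
      using U(1) by (intro open_INT) auto
    ultimately show ?thesis by (auto simp: openin_open)
  qed
  have disjF: "disjoint_family_on F {..4 * N + 4}"
  proof -
    have "F l \<inter> F m = {}" if lm: "l < m" "m \<le> 4 * N + 4" for l m
    proof -
      \<comment> \<open>At this entry \<open>l - 4 * i\<close> is still below the cap 4, and the
        value for \<open>m\<close> is larger even after capping. So the two sets lie in different
        regions of one disjoint family.\<close>
      define i where "i = l div 4"
      have "4 * i \<le> l" "l < 4 * i + 4"
        unfolding i_def by simp_all
      then have "i \<le> N" and "l - 4 * i < 4" "l - 4 * i < m - 4 * i"
        using lm by linarith+
      then have i: "i \<le> N" "min 4 (l - 4 * i) \<noteq> min 4 (m - 4 * i)"
        by (auto simp: min_def)
      then have "R i (min 4 (l - 4 * i)) \<inter> R i (min 4 (m - 4 * i)) = {}"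
        using disj[OF i(1)] unfolding disjoint_family_on_def by (metis atMost_iff min.cobounded1)
      then show ?thesis using i by (auto simp: F_def)
    qed
    then show ?thesis
      unfolding disjoint_family_on_def by (metis atMost_iff inf_commute linorder_neqE_nat)
  qed
  have conn: "connected (F l)" for l
    using sc[of l] by (simp add: strictly_convex_def convex_connected)
  note comps = components_disjoint_UN[of "{..4 * N + 4}" F, folded W, OF conn opF disjF]
  show "C \<in> components W \<Longrightarrow> strictly_convex C"
    unfolding comps(1) using sc by auto
  show "card (components W) = card {l. l \<le> 4 * N + 4 \<and> F l \<noteq> {}}"
    unfolding comps(2) by (rule arg_cong[of _ _ card]) auto
qed

section \<open>The five regions left by one hyperbola\<close>

text \<open>Left of, above, below, at, and right of the centre, numbered 0 to 4.\<close>

definition region :: "real \<Rightarrow> real \<Rightarrow> real \<Rightarrow> nat \<Rightarrow> (real \<times> real) set" where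
  "region a p q x =
    (if x = 0 then {y. sqrt ((snd y)\<^sup>2 + p\<^sup>2) < a - fst y}
     else if x = 1 then {y. sqrt ((fst y - a)\<^sup>2 + q\<^sup>2) < snd y}
     else if x = 2 then {y. sqrt ((fst y - a)\<^sup>2 + q\<^sup>2) < - snd y}
     else if x = 3 then {(a, 0)}
     else {y. sqrt ((snd y)\<^sup>2 + p\<^sup>2) < fst y - a})"

lemma le_4_cases:
  fixes x :: nat
  assumes "x \<le> 4"
  obtains "x = 0" | "x = 1" | "x = 2" | "x = 3" | "x = 4"
proof -
  from assms have "x = 0 \<or> x = 1 \<or> x = 2 \<or> x = 3 \<or> x = 4" by presburger
  then show ?thesis using that by blast
qed

lemma strictly_convex_region:
  assumes "0 < p" "0 < q"
  shows "strictly_convex (region a p q x)"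
proof -
  note branch = strictly_convex_hyperbola_branch
  have "strictly_convex {y::real \<times> real. sqrt ((snd y)\<^sup>2 + p\<^sup>2) < a - fst y}"
    using assms by (intro branch continuous_intros) (auto simp: algebra_simps prod_eq_iff)
  moreover have "strictly_convex {y::real \<times> real. sqrt ((snd y)\<^sup>2 + p\<^sup>2) < fst y - a}"
    using assms by (intro branch continuous_intros) (auto simp: algebra_simps prod_eq_iff)
  moreover have "strictly_convex {y::real \<times> real. sqrt ((fst y - a)\<^sup>2 + q\<^sup>2) < snd y}"
    using assms by (intro branch continuous_intros) (auto simp: algebra_simps prod_eq_iff)
  moreover have "strictly_convex {y::real \<times> real. sqrt ((fst y - a)\<^sup>2 + q\<^sup>2) < - snd y}"
    using assms by (intro branch continuous_intros) (auto simp: algebra_simps prod_eq_iff)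
  ultimately show ?thesis
    by (simp add: region_def strictly_convex_singleton)
qed

lemma abs_less_sqrt_sum_squares:
  fixes a c :: real
  assumes "0 < c"
  shows "\<bar>a\<bar> < sqrt (a\<^sup>2 + c\<^sup>2)"
  using assms by (intro real_less_rsqrt) simp

text \<open>Each branch region lies in one of the four open sectors between the diagonals through
  (a, 0), the common asymptotes. The sectors and the centre are pairwise disjoint, which separates
  the regions.\<close>

lemma region_bounds:
  assumes "0 < p" "0 < q"
  shows "y \<in> region a p q 0 \<Longrightarrow> \<bar>snd y\<bar> < a - fst y"
    and "y \<in> region a p q 1 \<Longrightarrow> \<bar>fst y - a\<bar> < snd y"
    and "y \<in> region a p q 2 \<Longrightarrow> \<bar>fst y - a\<bar> < - snd y"
    and "y \<in> region a p q 3 \<Longrightarrow> fst y = a \<and> snd y = 0"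
    and "y \<in> region a p q 4 \<Longrightarrow> \<bar>snd y\<bar> < fst y - a"
  using less_trans[OF abs_less_sqrt_sum_squares[OF assms(1)]]
    less_trans[OF abs_less_sqrt_sum_squares[OF assms(2)]]
  by (simp_all add: region_def)

lemma disjoint_region:
  assumes "0 < p" "0 < q"
  shows "disjoint_family_on (region a p q) {..4}"
proof -
  have "m = n" if "y \<in> region a p q m" "y \<in> region a p q n" "m \<le> 4" "n \<le> 4" for y m n
    using that(3,4,1,2)
    by (elim le_4_cases; hypsubst) (use region_bounds[OF assms, of y a] in force)+
  then show ?thesis
    unfolding disjoint_family_on_def by blast
qed

lemma region_0_disjoint:
  assumes "0 < p" "0 < q" "y \<in> region a p q 0" "0 < x" "x \<le> 4"
  shows "y \<notin> region a p q x"
  using disjoint_family_onD[OF disjoint_region[OF assms(1,2)], of 0 x a] assms by auto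

text \<open>Squaring merges each pair of opposite branches into one quadratic inequality. This
  algebraic form is the one that the zero set of the polynomial yields.\<close>

lemma region_eq:
  assumes "0 < p" "0 < q"
  shows "(\<Union>x\<le>4. region a p q x)
    = {y. p\<^sup>2 < (fst y - a)\<^sup>2 - (snd y)\<^sup>2 \<or> (fst y - a)\<^sup>2 - (snd y)\<^sup>2 < - q\<^sup>2 \<or> y = (a, 0)}"
proof -
  have iff: "sqrt (u\<^sup>2 + c\<^sup>2) < v \<or> sqrt (u\<^sup>2 + c\<^sup>2) < - v \<longleftrightarrow> c\<^sup>2 < v\<^sup>2 - u\<^sup>2"
    for u v c :: real
  proof -
    have "sqrt (u\<^sup>2 + c\<^sup>2) < v \<or> sqrt (u\<^sup>2 + c\<^sup>2) < - v \<longleftrightarrow> sqrt (u\<^sup>2 + c\<^sup>2) < sqrt (v\<^sup>2)"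
      by (auto simp: abs_if)
    also have "\<dots> \<longleftrightarrow> c\<^sup>2 < v\<^sup>2 - u\<^sup>2"
      unfolding real_sqrt_less_iff by linarith
    finally show ?thesis .
  qed
  show ?thesis
  proof (rule set_eqI)
    fix y
    have "{..4} = {0, 4, 1, 2, 3::nat}" by auto
    then have "y \<in> (\<Union>x\<le>4. region a p q x) \<longleftrightarrow>
        (y \<in> region a p q 4 \<or> y \<in> region a p q 0)
        \<or> (y \<in> region a p q 1 \<or> y \<in> region a p q 2) \<or> y \<in> region a p q 3"
      by auto
    also have "y \<in> region a p q 4 \<or> y \<in> region a p q 0 \<longleftrightarrow> p\<^sup>2 < (fst y - a)\<^sup>2 - (snd y)\<^sup>2"
      using iff[of "snd y" p "fst y - a"] by (simp add: region_def)
    also have "y \<in> region a p q 1 \<or> y \<in> region a p q 2 \<longleftrightarrow> q\<^sup>2 < (snd y)\<^sup>2 - (fst y - a)\<^sup>2"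
      using iff[of "fst y - a" q "snd y"] by (simp add: region_def)
    also have "\<dots> \<longleftrightarrow> (fst y - a)\<^sup>2 - (snd y)\<^sup>2 < - q\<^sup>2"
      by linarith
    finally show "y \<in> (\<Union>x\<le>4. region a p q x) \<longleftrightarrow> y \<in> {y. p\<^sup>2 < (fst y - a)\<^sup>2 - (snd y)\<^sup>2
        \<or> (fst y - a)\<^sup>2 - (snd y)\<^sup>2 < - q\<^sup>2 \<or> y = (a, 0)}"
      by (simp add: region_def)
  qed
qed

text \<open>The branch regions are open in the plane. The centre is isolated: the open set -q^2 <
  (y1 - a)^2 - y2^2 < p^2 contains it and meets no branch region.\<close>

lemma openin_region:
  assumes "0 < p" "0 < q" "x \<le> 4"
  shows "openin (top_of_set (\<Union>x\<le>4. region a p q x)) (region a p q x)"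
proof (cases "x = 3")
  case False
  have "open (region a p q x)"
    using False by (auto simp: region_def intro!: open_Collect_less continuous_intros)
  then show ?thesis
    using assms by (intro open_subset UN_upper) auto
next
  case True
  define U where "U = {y :: real \<times> real. (fst y - a)\<^sup>2 - (snd y)\<^sup>2 < p\<^sup>2}
      \<inter> {y. - q\<^sup>2 < (fst y - a)\<^sup>2 - (snd y)\<^sup>2}"
  have "open U"
    unfolding U_def by (intro open_Int open_Collect_less continuous_intros)
  moreover have "region a p q x = (\<Union>x\<le>4. region a p q x) \<inter> U"
    unfolding region_eq[OF assms(1,2)] using assms True
    by (auto simp: region_def U_def)
  ultimately show ?thesis by (auto simp: openin_open)
qed

section \<open>Imaginary projections of products and of the two conics\<close>

lemma mem_imaginary_projection:
  "y \<in> imaginary_projection p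
    \<longleftrightarrow> (\<exists>u v. eval2 p (Complex u (fst y)) (Complex v (snd y)) = 0)"
proof
  assume "y \<in> imaginary_projection p"
  then obtain z w where "y = (Im z, Im w)" "eval2 p z w = 0"
    by (auto simp: imaginary_projection_def)
  then show "\<exists>u v. eval2 p (Complex u (fst y)) (Complex v (snd y)) = 0"
    by (intro exI[of _ "Re z"] exI[of _ "Re w"]) simp
next
  assume "\<exists>u v. eval2 p (Complex u (fst y)) (Complex v (snd y)) = 0"
  then obtain u v where "eval2 p (Complex u (fst y)) (Complex v (snd y)) = 0" by blast
  then show "y \<in> imaginary_projection p"
    unfolding imaginary_projection_def
    by (intro CollectI exI[of _ "Complex u (fst y)"] exI[of _ "Complex v (snd y)"])
      (simp add: prod_eq_iff)
qed

lemma imaginary_projection_mult: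
  "imaginary_projection (p * q) = imaginary_projection p \<union> imaginary_projection q"
  by (intro set_eqI)
    (simp add: mem_imaginary_projection eval2_def ex_disj_distrib)

lemma imaginary_projection_prod:
  assumes "finite I"
  shows "imaginary_projection (\<Prod>i\<in>I. p i) = (\<Union>i\<in>I. imaginary_projection (p i))"
  using assms
proof (induction rule: finite_induct)
  case empty
  then show ?case by (auto simp: mem_imaginary_projection eval2_def)
qed (simp add: imaginary_projection_mult)

definition ellipse_poly :: "real \<Rightarrow> complex poly poly" where
  "ellipse_poly A = [:[:of_real (A\<^sup>2), 0, 1:], 0, [:of_real (A\<^sup>2):]:]"

definition hyperbola_poly :: "real \<Rightarrow> real \<Rightarrow> real \<Rightarrow> complex poly poly" where
  "hyperbola_poly a p q =
    [:[:- of_real (a\<^sup>2) - (Complex q p)\<^sup>2, - 2 * \<i> * of_real a, 1:], 0, [:- 1:]:]"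

lemma eval2_ellipse_poly: "eval2 (ellipse_poly A) z w = z\<^sup>2 + of_real (A\<^sup>2) * w\<^sup>2 + of_real (A\<^sup>2)"
  by (simp add: eval2_def ellipse_poly_def power2_eq_square algebra_simps)

lemma eval2_hyperbola_poly:
  "eval2 (hyperbola_poly a p q) z w = (z - \<i> * of_real a)\<^sup>2 - w\<^sup>2 - (Complex q p)\<^sup>2"
  by (simp add: eval2_def hyperbola_poly_def power2_eq_square algebra_simps)

text \<open>For the form x^2 + A^2 y^2, the real vector (u, v) of a zero must be orthogonal to the
  imaginary vector (s, t) and have squared norm Q - A^2, where Q is that of (s, t). Such a vector
  exists exactly if Q \<ge> A^2.\<close>

lemma imaginary_projection_ellipse_poly:
  assumes "0 < A"
  shows "- imaginary_projection (ellipse_poly A) = {y. (fst y)\<^sup>2 + A\<^sup>2 * (snd y)\<^sup>2 < A\<^sup>2}"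
proof -
  have zero_iff: "eval2 (ellipse_poly A) (Complex u s) (Complex v t) = 0
      \<longleftrightarrow> u\<^sup>2 + A\<^sup>2 * v\<^sup>2 = s\<^sup>2 + A\<^sup>2 * t\<^sup>2 - A\<^sup>2 \<and> u * s + A\<^sup>2 * (v * t) = 0" for u v s t
    unfolding eval2_ellipse_poly complex_eq_iff
    by (auto simp: power2_eq_square algebra_simps)
  have "y \<in> imaginary_projection (ellipse_poly A) \<longleftrightarrow> A\<^sup>2 \<le> (fst y)\<^sup>2 + A\<^sup>2 * (snd y)\<^sup>2" for y
  proof
    assume "y \<in> imaginary_projection (ellipse_poly A)"
    then obtain u v where "u\<^sup>2 + A\<^sup>2 * v\<^sup>2 = (fst y)\<^sup>2 + A\<^sup>2 * (snd y)\<^sup>2 - A\<^sup>2"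
      by (auto simp: mem_imaginary_projection zero_iff)
    moreover have "0 \<le> u\<^sup>2 + A\<^sup>2 * v\<^sup>2" by simp
    ultimately show "A\<^sup>2 \<le> (fst y)\<^sup>2 + A\<^sup>2 * (snd y)\<^sup>2" by linarith
  next
    assume *: "A\<^sup>2 \<le> (fst y)\<^sup>2 + A\<^sup>2 * (snd y)\<^sup>2"
    define s t Q where "s = fst y" and "t = snd y" and "Q = s\<^sup>2 + A\<^sup>2 * t\<^sup>2"
    have Q: "A\<^sup>2 \<le> Q" "0 < Q"
      using * less_le_trans[OF zero_less_power[OF assms, of 2] *]
      by (simp_all add: Q_def s_def t_def)
    \<comment> \<open>The vector (A t, -s / A) is orthogonal to (s, t) and has the same squared norm
      Q; the factor \<open>r\<close> rescales this to Q - A^2.\<close>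
    define r where "r = sqrt ((Q - A\<^sup>2) / Q)"
    have r: "r\<^sup>2 * Q = Q - A\<^sup>2"
      using Q by (simp add: r_def)
    have "(r * (A * t))\<^sup>2 + A\<^sup>2 * (- r * s / A)\<^sup>2 = r\<^sup>2 * Q"
      using assms by (simp add: Q_def power_mult_distrib power_divide algebra_simps)
    moreover have "r * (A * t) * s + A\<^sup>2 * (- r * s / A * t) = 0"
      using assms by (simp add: power2_eq_square)
    ultimately have "eval2 (ellipse_poly A) (Complex (r * (A * t)) s) (Complex (- r * s / A) t) = 0"
      unfolding zero_iff r by (simp add: Q_def)
    then show "y \<in> imaginary_projection (ellipse_poly A)"
      unfolding mem_imaginary_projection s_def t_def by blast
  qed
  then show ?thesis by (auto simp: not_le)
qed

text \<open>For the indefinite form x^2 - y^2, the equations prescribe the value of the form at the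
  real vector (u, v) and its product with the shifted imaginary vector (d, t). By \<open>key\<close>
  and \<open>prod\<close>, a solution makes (p^2 - D)(q^2 + D) a square, where D is the value at (d,
  t). Conversely, nonnegativity of that product suffices for D \<noteq> 0; isotropic (d, t) are
  treated separately.\<close>

lemma imaginary_projection_hyperbola_poly:
  assumes "0 < p" "0 < q"
  shows "- imaginary_projection (hyperbola_poly a p q) = (\<Union>x\<le>4. region a p q x)"
proof -
  have zero_iff: "eval2 (hyperbola_poly a p q) (Complex u s) (Complex v t) = 0
      \<longleftrightarrow> u\<^sup>2 - v\<^sup>2 = (s - a)\<^sup>2 - t\<^sup>2 + q\<^sup>2 - p\<^sup>2 \<and> u * (s - a) - v * t = p * q" for u v s t
    unfolding eval2_hyperbola_poly complex_eq_iff
    by (auto simp: power2_eq_square algebra_simps)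
  have "y \<in> imaginary_projection (hyperbola_poly a p q) \<longleftrightarrow>
      \<not> (p\<^sup>2 < (fst y - a)\<^sup>2 - (snd y)\<^sup>2 \<or> (fst y - a)\<^sup>2 - (snd y)\<^sup>2 < - q\<^sup>2 \<or> y = (a, 0))" for y
  proof -
    define d t D where "d = fst y - a" and "t = snd y" and "D = d\<^sup>2 - t\<^sup>2"
    have origin: "y = (a, 0) \<longleftrightarrow> d = 0 \<and> t = 0"
      by (auto simp: d_def t_def prod_eq_iff)
    have mem: "y \<in> imaginary_projection (hyperbola_poly a p q)
        \<longleftrightarrow> (\<exists>u v. u\<^sup>2 - v\<^sup>2 = D + q\<^sup>2 - p\<^sup>2 \<and> u * d - v * t = p * q)"
      by (simp add: mem_imaginary_projection zero_iff d_def t_def D_def)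
    have key: "(u * d - v * t)\<^sup>2 - (u * t - v * d)\<^sup>2 = (u\<^sup>2 - v\<^sup>2) * D" for u v
      by (simp add: D_def power2_eq_square algebra_simps)
    have prod: "(p * q)\<^sup>2 - (D + q\<^sup>2 - p\<^sup>2) * D = (p\<^sup>2 - D) * (q\<^sup>2 + D)"
      by (simp add: power2_eq_square algebra_simps)
    have "(\<exists>u v. u\<^sup>2 - v\<^sup>2 = D + q\<^sup>2 - p\<^sup>2 \<and> u * d - v * t = p * q)
        \<longleftrightarrow> \<not> (p\<^sup>2 < D \<or> D < - q\<^sup>2 \<or> d = 0 \<and> t = 0)"
    proof
      assume "\<exists>u v. u\<^sup>2 - v\<^sup>2 = D + q\<^sup>2 - p\<^sup>2 \<and> u * d - v * t = p * q"
      then obtain u v where uv: "u\<^sup>2 - v\<^sup>2 = D + q\<^sup>2 - p\<^sup>2" "u * d - v * t = p * q" by blast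
      have "(p\<^sup>2 - D) * (q\<^sup>2 + D) = (u * t - v * d)\<^sup>2"
        using key[of u v] prod unfolding uv by linarith
      then have nonneg: "0 \<le> (p\<^sup>2 - D) * (q\<^sup>2 + D)" by simp
      have "0 < p\<^sup>2" "0 < q\<^sup>2" using assms by simp_all
      \<comment> \<open>The two factors have the positive sum p^2 + q^2, so they cannot both be
        nonpositive.\<close>
      then have "\<not> p\<^sup>2 < D" "\<not> D < - q\<^sup>2"
        using nonneg unfolding zero_le_mult_iff by linarith+
      moreover have "\<not> (d = 0 \<and> t = 0)" using uv(2) assms by auto
      ultimately show "\<not> (p\<^sup>2 < D \<or> D < - q\<^sup>2 \<or> d = 0 \<and> t = 0)" by blast
    next
      assume *: "\<not> (p\<^sup>2 < D \<or> D < - q\<^sup>2 \<or> d = 0 \<and> t = 0)"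
      show "\<exists>u v. u\<^sup>2 - v\<^sup>2 = D + q\<^sup>2 - p\<^sup>2 \<and> u * d - v * t = p * q"
      proof (cases "D = 0")
        case True
        then have "t = d \<or> t = - d" by (simp add: D_def flip: power2_eq_iff)
        then obtain e where e: "t = e * d" "e\<^sup>2 = 1"
          using that[of 1] that[of "- 1"] by auto
        with * have "d \<noteq> 0" by auto
        \<comment> \<open>On the isotropic line t = e d the system decouples in u - e v and u + e v:
          the former must be \<open>m\<close>, and the product of the two must be q^2 - p^2.\<close>
        define m n where "m = p * q / d" and "n = (q\<^sup>2 - p\<^sup>2) / m"
        have "m \<noteq> 0" using assms \<open>d \<noteq> 0\<close> by (simp add: m_def)
        have "((m + n) / 2)\<^sup>2 - (e * (n - m) / 2)\<^sup>2 = m * n"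
          using e(2) by (simp add: power_mult_distrib power_divide) (simp add: power2_eq_square field_simps)
        also have "\<dots> = D + q\<^sup>2 - p\<^sup>2"
          using \<open>m \<noteq> 0\<close> True by (simp add: n_def)
        finally have "((m + n) / 2)\<^sup>2 - (e * (n - m) / 2)\<^sup>2 = D + q\<^sup>2 - p\<^sup>2" .
        moreover have "(m + n) / 2 * d - e * (n - m) / 2 * t = p * q"
        proof -
          have "(m + n) / 2 * d - e * (n - m) / 2 * t = (m + n) / 2 * d - e\<^sup>2 * ((n - m) / 2 * d)"
            unfolding e(1) by (simp add: power2_eq_square algebra_simps)
          also have "\<dots> = m * d" unfolding e(2) by (simp add: field_simps)
          finally show ?thesis using \<open>d \<noteq> 0\<close> by (simp add: m_def)
        qed
        ultimately show ?thesis by blast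
      next
        case False
        \<comment> \<open>\<open>X\<close> and \<open>Y\<close> are the intended values of u d - v t
          and u t - v d, with Y^2 forced by \<open>key\<close>. Solving this linear system, of
          determinant -D, yields u and v.\<close>
        define X Y where "X = p * q" and "Y = sqrt ((p\<^sup>2 - D) * (q\<^sup>2 + D))"
        define u v where "u = (X * d - Y * t) / D" and "v = (X * t - Y * d) / D"
        have Y: "Y\<^sup>2 = (p\<^sup>2 - D) * (q\<^sup>2 + D)"
          using * by (simp add: Y_def)
        have uv: "u * D = X * d - Y * t" "v * D = X * t - Y * d"
          using False by (simp_all add: u_def v_def)
        have "(u * d - v * t) * D = (u * D) * d - (v * D) * t"
          "(u * t - v * d) * D = (u * D) * t - (v * D) * d"
          by (simp_all add: algebra_simps)
        then have "(u * d - v * t) * D = X * D" "(u * t - v * d) * D = Y * D"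
          unfolding uv by (simp_all add: D_def power2_eq_square algebra_simps)
        then have XY: "u * d - v * t = X" "u * t - v * d = Y"
          using False by simp_all
        have "(u\<^sup>2 - v\<^sup>2) * D = (D + q\<^sup>2 - p\<^sup>2) * D"
          using key[of u v] prod Y unfolding XY X_def by linarith
        then show ?thesis using False XY(1) by (auto simp: X_def)
      qed
    qed
    then show ?thesis
      unfolding mem origin by (simp add: D_def d_def t_def)
  qed
  then show ?thesis
    unfolding region_eq[OF assms] by (auto simp del: not_less)
qed

section \<open>Total degree of the product of conics\<close>

lemma total_degree_le_iff:
  "total_degree p \<le> d \<longleftrightarrow> (\<forall>i j. coeff (coeff p j) i \<noteq> 0 \<longrightarrow> i + j \<le> d)"
  unfolding total_degree_def using finite_total_degree_set[of p] by (subst Max_le_iff) auto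

lemma total_degree_mult_le:
  "total_degree (p * q) \<le> total_degree p + total_degree q"
  unfolding total_degree_le_iff
proof (intro allI impI)
  fix i j assume "coeff (coeff (p * q) j) i \<noteq> 0"
  then have "(\<Sum>k\<le>j. \<Sum>l\<le>i. coeff (coeff p k) l * coeff (coeff q (j - k)) (i - l)) \<noteq> 0"
    by (simp add: coeff_mult coeff_sum)
  then obtain k where k: "k \<le> j"
    "(\<Sum>l\<le>i. coeff (coeff p k) l * coeff (coeff q (j - k)) (i - l)) \<noteq> 0"
    using sum.not_neutral_contains_not_neutral by (metis (no_types, lifting) atMost_iff)
  then obtain l where l: "l \<le> i" "coeff (coeff p k) l * coeff (coeff q (j - k)) (i - l) \<noteq> 0"
    using sum.not_neutral_contains_not_neutral by (metis (no_types, lifting) atMost_iff)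
  have "l + k \<le> total_degree p" "i - l + (j - k) \<le> total_degree q"
    using l(2) total_degree_le_iff[of p "total_degree p"] total_degree_le_iff[of q "total_degree q"]
    by auto
  then show "i + j \<le> total_degree p + total_degree q"
    using k l by linarith
qed

lemma total_degree_prod_le:
  assumes "finite I"
  shows "total_degree (\<Prod>i\<in>I. p i) \<le> (\<Sum>i\<in>I. total_degree (p i))"
  using assms
proof (induction rule: finite_induct)
  case empty
  then show ?case using total_degree_le_iff[of 1 0] by (simp add: coeff_1)
next
  case (insert i I)
  then show ?case using total_degree_mult_le[of "p i" "\<Prod>i\<in>I. p i"] by simp
qed

text \<open>\<open>coeff p 0\<close> is the restriction of \<open>p\<close> to z2 = 0. Restriction
  respects products, so this gives lower bounds for the total degree of a product.\<close>

lemma degree_coeff_0_le_total_degree: "degree (coeff p 0) \<le> total_degree p"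
proof (cases "coeff p 0 = 0")
  case False
  then show ?thesis
    using total_degree_le_iff[THEN iffD1, OF order_refl, rule_format, of p 0 "degree (coeff p 0)"]
    by simp
qed simp

lemma coeff_0_prod:
  fixes p :: "'a \<Rightarrow> 'b::comm_semiring_1 poly"
  shows "coeff (\<Prod>i\<in>I. p i) 0 = (\<Prod>i\<in>I. coeff (p i) 0)"
  by (induction I rule: infinite_finite_induct) (simp_all add: coeff_mult_0)

lemma total_degree_conic_le:
  fixes P :: "complex poly"
  assumes "degree P \<le> 2"
  shows "total_degree [:P, 0, [:c:]:] \<le> 2"
  unfolding total_degree_le_iff
proof (intro allI impI)
  fix i j assume *: "coeff (coeff [:P, 0, [:c:]:] j) i \<noteq> 0"
  then consider "j = 0" "coeff P i \<noteq> 0" | "j = 2" "coeff [:c:] i \<noteq> 0"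
    by (auto simp: coeff_pCons split: nat.splits)
  then show "i + j \<le> 2"
  proof cases
    case 1
    then show ?thesis using assms le_degree[of P i] by simp
  next
    case 2
    then show ?thesis by (auto simp: coeff_pCons split: nat.splits)
  qed
qed

text \<open>Subadditivity gives the upper bound. For the lower one, every factor restricts at z2 = 0
  to a monic quadratic in z1, so the degrees add up.\<close>

lemma total_degree_ellipse_hyperbolas:
  assumes "finite I"
  shows "total_degree (ellipse_poly A * (\<Prod>i\<in>I. hyperbola_poly (a i) (p i) (q i))) = 2 * card I + 2"
    (is "total_degree (?E * ?H) = _")
proof (rule antisym)
  have "total_degree ?H \<le> (\<Sum>i\<in>I. 2)"
    by (intro order.trans[OF total_degree_prod_le[OF assms]] sum_mono)
      (simp add: hyperbola_poly_def total_degree_conic_le)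
  moreover have "total_degree ?E \<le> 2"
    by (simp add: ellipse_poly_def total_degree_conic_le)
  ultimately show "total_degree (?E * ?H) \<le> 2 * card I + 2"
    using total_degree_mult_le[of ?E ?H] by simp
  have deg: "degree (coeff (hyperbola_poly (a i) (p i) (q i)) 0) = 2" for i
    by (simp add: hyperbola_poly_def)
  then have nz: "coeff (hyperbola_poly (a i) (p i) (q i)) 0 \<noteq> 0" for i
    by (metis degree_0 zero_neq_numeral)
  have "degree (coeff ?H 0) = (\<Sum>i\<in>I. 2)" "coeff ?H 0 \<noteq> 0"
    unfolding coeff_0_prod using assms nz by (simp_all add: degree_prod_sum_eq deg)
  moreover have "degree (coeff ?E 0) = 2" "coeff ?E 0 \<noteq> 0"
    by (simp_all add: ellipse_poly_def)
  ultimately have "degree (coeff (?E * ?H) 0) = 2 * card I + 2"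
    unfolding coeff_mult_0 by (subst degree_mult_eq) simp_all
  then show "2 * card I + 2 \<le> total_degree (?E * ?H)"
    using degree_coeff_0_le_total_degree[of "?E * ?H"] by simp
qed

section \<open>Hyperbolas side by side in a flat ellipse\<close>

text \<open>For |y2| < 1 the left and right branches stay within distance p + 1 of the line y1 = a,
  because y2^2 + p^2 < (p + 1)^2.\<close>

lemma region_outer:
  assumes "\<bar>snd y\<bar> < 1" "0 < p"
  shows "p + 1 \<le> a - fst y \<Longrightarrow> y \<in> region a p q 0"
    and "p + 1 \<le> fst y - a \<Longrightarrow> y \<in> region a p q 4"
proof -
  have "(snd y)\<^sup>2 + p\<^sup>2 < 1 + p\<^sup>2"
    using assms abs_square_less_1 by auto
  also have "\<dots> \<le> (p + 1)\<^sup>2"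
    using assms by (simp add: power2_eq_square algebra_simps)
  finally have "sqrt ((snd y)\<^sup>2 + p\<^sup>2) < p + 1"
    using assms by (intro real_less_lsqrt) auto
  then show "p + 1 \<le> a - fst y \<Longrightarrow> y \<in> region a p q 0"
    "p + 1 \<le> fst y - a \<Longrightarrow> y \<in> region a p q 4"
    by (simp_all add: region_def)
qed

lemma ellipse_bounds:
  fixes A :: real
  assumes "0 < A" "(fst y)\<^sup>2 + A\<^sup>2 * (snd y)\<^sup>2 < A\<^sup>2"
  shows "\<bar>fst y\<bar> < A" "\<bar>snd y\<bar> < 1"
proof -
  have "0 \<le> A\<^sup>2 * (snd y)\<^sup>2" by simp
  then have "(fst y)\<^sup>2 < A\<^sup>2" using assms by linarith
  then show "\<bar>fst y\<bar> < A" using assms by (simp add: real_less_rsqrt power2_less_imp_less)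
  have "0 \<le> (fst y)\<^sup>2" by simp
  then have "A\<^sup>2 * (snd y)\<^sup>2 < A\<^sup>2 * 1" using assms by linarith
  then have "(snd y)\<^sup>2 < 1" using assms by (simp only: mult_less_cancel_left_pos zero_less_power)
  then show "\<bar>snd y\<bar> < 1" by (simp add: abs_square_less_1)
qed

text \<open>By \<open>gap\<close> the vertical strips of half-width \<open>p i + 1\<close> about the
  centres have disjoint interiors and follow each other in index order. A point of the ellipse not
  left of hyperbola \<open>i\<close> is thus beyond the strips of all earlier ones, hence right of
  them: this is \<open>sep\<close>.\<close>

lemma components_ellipse_hyperbolas:
  fixes A :: real and a p q :: "nat \<Rightarrow> real" and N :: nat
  defines "P \<equiv> ellipse_poly A * (\<Prod>i\<le>N. hyperbola_poly (a i) (p i) (q i))"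
    and "E \<equiv> {y. (fst y)\<^sup>2 + A\<^sup>2 * (snd y)\<^sup>2 < A\<^sup>2}"
  assumes "0 < A"
    and pq: "\<And>i. i \<le> N \<Longrightarrow> 0 < p i" "\<And>i. i \<le> N \<Longrightarrow> 0 < q i"
    and gap: "\<And>i j. j < i \<Longrightarrow> i \<le> N \<Longrightarrow> a j + p j + 1 \<le> a i - p i - 1"
  shows "C \<in> components (- imaginary_projection P) \<Longrightarrow> strictly_convex C \<and> bounded C"
    and "card (components (- imaginary_projection P)) = card {l. l \<le> 4 * N + 4 \<and>
      E \<inter> (\<Inter>i\<le>N. region (a i) (p i) (q i) (min 4 (l - 4 * i))) \<noteq> {}}"
proof -
  have bounds: "\<bar>fst y\<bar> < A" "\<bar>snd y\<bar> < 1" if "y \<in> E" for y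
    using ellipse_bounds[OF \<open>0 < A\<close>] that by (simp_all add: E_def)
  have eq: "- imaginary_projection P = E \<inter> (\<Inter>i\<le>N. \<Union>x\<le>4. region (a i) (p i) (q i) x)"
  proof -
    have "- imaginary_projection P = - imaginary_projection (ellipse_poly A)
        \<inter> (\<Inter>i\<le>N. - imaginary_projection (hyperbola_poly (a i) (p i) (q i)))"
      unfolding P_def by (simp add: imaginary_projection_mult imaginary_projection_prod)
    also have "\<dots> = E \<inter> (\<Inter>i\<le>N. \<Union>x\<le>4. region (a i) (p i) (q i) x)"
      using pq imaginary_projection_hyperbola_poly imaginary_projection_ellipse_poly[OF \<open>0 < A\<close>]
      unfolding E_def by (intro arg_cong2[of _ _ _ _ "(\<inter>)"] INF_cong) auto
    finally show ?thesis .
  qed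
  have sep: "y \<in> region (a j) (p j) (q j) 4"
    if "j < i" "i \<le> N" "0 < x" "x \<le> 4" "y \<in> E" "y \<in> region (a i) (p i) (q i) x" for i j x y
  proof -
    have "y \<notin> region (a i) (p i) (q i) 0"
      using that region_0_disjoint[OF pq] by blast
    then have "a i - p i - 1 < fst y"
      using region_outer(1)[OF bounds(2)[OF \<open>y \<in> E\<close>] pq(1)[OF \<open>i \<le> N\<close>], of "a i"] by fastforce
    then have "p j + 1 \<le> fst y - a j"
      using gap[OF that(1,2)] by linarith
    then show ?thesis
      using that by (intro region_outer(2) bounds(2) pq) auto
  qed
  note arr = components_arrangement[of E N "\<lambda>i. region (a i) (p i) (q i)", folded eq]
  have E: "strictly_convex E"
    unfolding E_def using \<open>0 < A\<close> by (intro strictly_convex_ellipse) simp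
  have "E \<subseteq> {-A..A} \<times> {-1..1}"
    using bounds by (fastforce simp: abs_less_iff)
  then have bdd: "bounded E"
    by (rule bounded_subset[rotated]) (intro bounded_Times bounded_closed_interval)
  show "C \<in> components (- imaginary_projection P) \<Longrightarrow> strictly_convex C \<and> bounded C"
  proof
    assume C: "C \<in> components (- imaginary_projection P)"
    show "strictly_convex C"
      by (rule arr(1)[OF _ _ _ _ _ C])
        (use E pq strictly_convex_region openin_region disjoint_region sep in auto)
    show "bounded C"
      using bounded_subset[OF bdd] in_components_subset[OF C] eq by auto
  qed
  show "card (components (- imaginary_projection P)) = card {l. l \<le> 4 * N + 4 \<and>
      E \<inter> (\<Inter>i\<le>N. region (a i) (p i) (q i) (min 4 (l - 4 * i))) \<noteq> {}}"
    by (rule arr(2)) (use E pq strictly_convex_region openin_region disjoint_region sep in auto)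
qed

section \<open>Choice of the parameters and count of the components\<close>

theorem theorem7p1:
  fixes k :: nat
  assumes "k > 0"
  shows "\<exists>p :: complex poly poly.
           total_degree p = 2 * nat \<lceil>real k / 4\<rceil> + 2 \<and>
           card (components (- imaginary_projection p)) = k \<and>
           (\<forall>C \<in> components (- imaginary_projection p). strictly_convex C \<and> bounded C)"
proof -
  \<comment> \<open>The count is 1 + 4 N + r: one leftmost component, four for each of the
    hyperbolas 0 to N - 1, and \<open>r\<close> for hyperbola \<open>N\<close>.\<close>
  define N r where "N = (k - 1) div 4" and "r = (k - 1) mod 4"
  have k: "k = 4 * N + 1 + r" "r < 4"
    using assms by (simp_all add: N_def r_def)
  have "\<lceil>real k / 4\<rceil> = int (N + 1)"
    using k by (intro ceiling_unique) auto
  then have ceil: "nat \<lceil>real k / 4\<rceil> = N + 1"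
    by simp
  \<comment> \<open>The last hyperbola: centre outside the ellipse if \<open>r = 0\<close>; only the centre added if \<open>r = 1\<close>;
    centre and right branch if \<open>r = 2\<close>; centre, upper and lower branch if \<open>r = 3\<close>.\<close>
  define L A where "L = 4 * real N + 4" and "A = 2 * L"
  have L: "4 \<le> L" "0 < L" "0 < A" by (simp_all add: L_def A_def)
  \<comment> \<open>The first \<open>N\<close> centres are -4 N, ..., -4. Their spacing 4 makes the
    strips of half-width 2 just touch.\<close>
  define a where "a i = (if i < N then 4 * real i - 4 * real N else if r = 0 then 2 * A else L)" for i
  \<comment> \<open>With centre \<open>L\<close>, the value \<open>p N = L\<close> puts the right
    vertex at 2 L = \<open>A\<close>, on the ellipse, so no right region is left inside. Likewise
    \<open>q N = 1\<close> keeps the upper and lower regions out of |y2| < 1, while 1/2 lets them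
    in.\<close>
  define p where "p i = (if i < N \<or> r = 0 \<or> r = 2 then 1 else L)" for i
  define q :: "nat \<Rightarrow> real" where "q i = (if i < N \<or> r = 3 then 1 / 2 else 1)" for i
  define E where "E = {y :: real \<times> real. (fst y)\<^sup>2 + A\<^sup>2 * (snd y)\<^sup>2 < A\<^sup>2}"
  define R where "R i = region (a i) (p i) (q i)" for i
  define F where "F l = E \<inter> (\<Inter>i\<le>N. R i (min 4 (l - 4 * i)))" for l
  have pq: "0 < p i" "0 < q i" for i
    using L by (auto simp: p_def q_def)
  \<comment> \<open>-2 is where the strip about the centre -4 of hyperbola N - 1 ends.\<close>
  have last: "- 2 \<le> a N - p N - 1"
    using L by (auto simp: a_def p_def A_def)
  have gap: "a j + p j + 1 \<le> a i - p i - 1" if "j < i" "i \<le> N" for i j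
  proof (cases "i < N")
    case True
    then show ?thesis using that by (simp add: a_def p_def)
  next
    case False
    then show ?thesis using that last by (simp add: a_def p_def)
  qed
  have bounds: "\<bar>fst y\<bar> < A" "\<bar>snd y\<bar> < 1" if "y \<in> E" for y
    using ellipse_bounds[OF \<open>0 < A\<close>] that by (simp_all add: E_def)
  have outer: "p i + 1 \<le> a i - fst y \<Longrightarrow> y \<in> R i 0" "p i + 1 \<le> fst y - a i \<Longrightarrow> y \<in> R i 4"
    if "y \<in> E" for y i
    unfolding R_def using region_outer[OF bounds(2)[OF that] pq(1)] by blast+
  \<comment> \<open>As \<open>A\<close> is 2 L, this amounts to 1/4 + 9/16 < 1. The height 3/4 lies
    above the vertices at height 1/2.\<close>
  have mem_E: "(s, t) \<in> E" if "\<bar>s\<bar> \<le> L" "\<bar>t\<bar> \<le> 3 / 4" for s t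
  proof -
    have "s\<^sup>2 \<le> L\<^sup>2" "t\<^sup>2 \<le> (3 / 4)\<^sup>2"
      using that L by (simp_all only: abs_le_square_iff[symmetric])
    then have "s\<^sup>2 + A\<^sup>2 * t\<^sup>2 \<le> L\<^sup>2 + A\<^sup>2 * (3 / 4)\<^sup>2"
      by (intro add_mono mult_left_mono) auto
    also have "\<dots> < A\<^sup>2"
      using L by (simp add: A_def power2_eq_square)
    finally show ?thesis by (simp add: E_def)
  qed
  have disj: "y \<notin> R i x" if "y \<in> R i 0" "0 < x" "x \<le> 4" for y i x
    using that region_0_disjoint[OF pq] unfolding R_def by blast

  have F_multiple: "F (4 * i) \<noteq> {}" if "i \<le> N" for i
  proof -
    \<comment> \<open>A point 2 to the left of -4 N + 4 i: it is where the strips of hyperbolas i -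
      1 and i touch if 0 < i < N, left of every strip's interior if i = 0, and at -2 if i =
      N.\<close>
    define y :: "real \<times> real" where "y = (4 * real i - 4 * real N - 2, 0)"
    have y: "y \<in> E" unfolding y_def using that by (intro mem_E) (auto simp: L_def)
    have "y \<in> R j (min 4 (4 * i - 4 * j))" if "j \<le> N" for j
    proof (cases "j < i")
      case True
      then have "min 4 (4 * i - 4 * j) = 4" by simp
      moreover have "y \<in> R j 4"
        using True \<open>i \<le> N\<close> by (intro outer(2)[OF y]) (simp add: y_def a_def p_def)
      ultimately show ?thesis by simp
    next
      case False
      have "y \<in> R j 0"
      proof (rule outer(1)[OF y])
        show "p j + 1 \<le> a j - fst y"
          using False last \<open>j \<le> N\<close> by (cases "j = N") (simp_all add: y_def a_def p_def)
      qed
      then show ?thesis using False by simp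
    qed
    then show ?thesis using y by (auto simp: F_def)
  qed

  have F_inner: "F (4 * i + x) \<noteq> {}" if "i < N" "0 < x" "x < 4" for i x
  proof -
    define t :: real where "t = (if x = 1 then 3 / 4 else if x = 2 then - 3 / 4 else 0)"
    have y: "(a i, t) \<in> E"
      using that by (intro mem_E) (auto simp: L_def a_def t_def)
    have "(a i, t) \<in> R i x"
      using that by (auto simp: R_def region_def q_def t_def real_sqrt_divide)
    have "(a i, t) \<in> R j (min 4 (4 * i + x - 4 * j))" if "j \<le> N" for j
    proof (cases i j rule: linorder_cases)
      case less
      have "(a i, t) \<in> R j 0"
        using gap[OF less that] pq(1)[of i] by (intro outer(1)[OF y]) simp
      then show ?thesis using less \<open>x < 4\<close> by simp
    next
      case equal
      then show ?thesis using \<open>(a i, t) \<in> R i x\<close> \<open>x < 4\<close> by simp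
    next
      case greater
      have "(a i, t) \<in> R j 4"
        using gap[OF greater] \<open>i < N\<close> pq(1)[of i] by (intro outer(2)[OF y]) simp
      moreover have "4 \<le> 4 * i + x - 4 * j" using greater by linarith
      ultimately show ?thesis by (simp add: min_def)
    qed
    then show ?thesis using y by (auto simp: F_def)
  qed

  \<comment> \<open>A point of the ellipse that is not left of the last hyperbola is right of all
    earlier ones, so only the last region matters.\<close>
  have F_last: "F (4 * N + x) \<noteq> {} \<longleftrightarrow> E \<inter> R N x \<noteq> {}" if "0 < x" "x \<le> 4" for x
  proof -
    have "y \<in> R j (min 4 (4 * N + x - 4 * j))" if y: "y \<in> E" "y \<in> R N x" and "j \<le> N" for y j
    proof (cases "j = N")
      case True
      then show ?thesis using \<open>y \<in> R N x\<close> \<open>x \<le> 4\<close> by simp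
    next
      case False
      have "\<not> p N + 1 \<le> a N - fst y"
        using disj[OF _ \<open>0 < x\<close> \<open>x \<le> 4\<close>] outer(1)[OF y(1)] y(2) by blast
      then have "y \<in> R j 4"
        using gap[of j N] False \<open>j \<le> N\<close> by (intro outer(2)[OF y(1)]) simp
      moreover have "4 \<le> 4 * N + x - 4 * j" using False \<open>j \<le> N\<close> by linarith
      ultimately show ?thesis by (simp add: min_def)
    qed
    then have "E \<inter> R N x \<subseteq> F (4 * N + x)" by (auto simp: F_def)
    moreover have "F (4 * N + x) \<subseteq> E \<inter> R N (min 4 (4 * N + x - 4 * N))"
      unfolding F_def by blast
    then have "F (4 * N + x) \<subseteq> E \<inter> R N x" using \<open>x \<le> 4\<close> by simp
    ultimately show ?thesis by blast
  qed

  \<comment> \<open>For r = 0 the whole ellipse lies left of the last hyperbola.\<close>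
  have empty: "E \<inter> R N x = {}" if "r = 0" "0 < x" "x \<le> 4" for x
  proof -
    have "y \<in> R N 0" if "y \<in> E" for y
      using bounds(1)[OF that] \<open>r = 0\<close> L by (intro outer(1)[OF that]) (auto simp: a_def p_def A_def)
    then show ?thesis using disj that by blast
  qed
  have centre: "E \<inter> R N 3 \<noteq> {}" if "r \<noteq> 0"
  proof -
    have "(L, 0) \<in> E \<inter> R N 3"
      using that mem_E[of L 0] L by (simp add: R_def region_def a_def)
    then show ?thesis by blast
  qed
  have right: "E \<inter> R N 4 \<noteq> {} \<longleftrightarrow> r = 2" if "r \<noteq> 0"
  proof
    assume "r = 2"
    have "(L + 2)\<^sup>2 < A\<^sup>2"
      using L by (intro power_strict_mono) (auto simp: A_def)
    then have "(L + 2, 0) \<in> E \<inter> R N 4"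
      using \<open>r = 2\<close> by (simp add: E_def R_def region_def a_def p_def)
    then show "E \<inter> R N 4 \<noteq> {}" by blast
  next
    assume "E \<inter> R N 4 \<noteq> {}"
    then obtain y where y: "y \<in> E" "y \<in> R N 4" by blast
    show "r = 2"
    proof (rule ccontr)
      assume "r \<noteq> 2"
      then have "sqrt ((snd y)\<^sup>2 + L\<^sup>2) < fst y - L"
        using y that by (simp add: R_def region_def a_def p_def)
      moreover have "L \<le> sqrt ((snd y)\<^sup>2 + L\<^sup>2)"
        using L by (intro real_le_rsqrt) simp
      ultimately show False using bounds(1)[OF y(1)] unfolding A_def by linarith
    qed
  qed
  have top: "E \<inter> R N x \<noteq> {} \<longleftrightarrow> r = 3" if "r \<noteq> 0" "x = 1 \<or> x = 2" for x
  proof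
    assume "r = 3"
    define t :: real where "t = (if x = 1 then 3 / 4 else - 3 / 4)"
    have "(L, t) \<in> E \<inter> R N x"
      using that \<open>r = 3\<close> mem_E[of L t] L
      by (auto simp: R_def region_def a_def q_def t_def real_sqrt_divide)
    then show "E \<inter> R N x \<noteq> {}" by blast
  next
    assume "E \<inter> R N x \<noteq> {}"
    then obtain y where y: "y \<in> E" "y \<in> R N x" by blast
    show "r = 3"
    proof (rule ccontr)
      assume "r \<noteq> 3"
      then have "sqrt ((fst y - L)\<^sup>2 + 1) < \<bar>snd y\<bar>"
        using y that by (auto simp: R_def region_def a_def q_def)
      moreover have "1 \<le> sqrt ((fst y - L)\<^sup>2 + 1)"
        by (intro real_le_rsqrt) simp
      ultimately show False using bounds(2)[OF y(1)] by linarith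
    qed
  qed

  \<comment> \<open>The regions that the last hyperbola contributes; region 0 is left out because it
    belongs to \<open>F (4 * N)\<close>.\<close>
  define X where "X = {x \<in> {1..4}. E \<inter> R N x \<noteq> {}}"
  have "card X = r"
  proof -
    have split: "{1..4} = {1, 2, 3, 4::nat}" by auto
    consider "r = 0" | "r = 1" | "r = 2" | "r = 3" using k(2) by linarith
    then show ?thesis
    proof cases
      case 1
      then have "X = {}" using empty unfolding X_def by auto
      then show ?thesis using 1 by simp
    next
      case 2
      then have "X = {3}" using centre right top unfolding X_def split by auto
      then show ?thesis using 2 by simp
    next
      case 3
      then have "X = {3, 4}" using centre right top unfolding X_def split by auto
      then show ?thesis using 3 by simp
    next
      case 4
      then have "X = {1, 2, 3}" using centre right top unfolding X_def split by auto
      then show ?thesis using 4 by simp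
    qed
  qed
  have "{l. l \<le> 4 * N + 4 \<and> F l \<noteq> {}} = {..4 * N} \<union> (+) (4 * N) ` X"
  proof (intro equalityI subsetI)
    fix l assume l: "l \<in> {l. l \<le> 4 * N + 4 \<and> F l \<noteq> {}}"
    show "l \<in> {..4 * N} \<union> (+) (4 * N) ` X"
    proof (cases "l \<le> 4 * N")
      case False
      then obtain x where x: "l = 4 * N + x" "0 < x"
        using less_imp_add_positive[of "4 * N" l] by auto
      then have "x \<in> X"
        using l F_last[of x] by (simp add: X_def)
      then show ?thesis using x(1) by blast
    qed simp
  next
    fix l assume "l \<in> {..4 * N} \<union> (+) (4 * N) ` X"
    then show "l \<in> {l. l \<le> 4 * N + 4 \<and> F l \<noteq> {}}"
    proof
      assume l: "l \<in> {..4 * N}"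
      \<comment> \<open>Remainder 0 gives a set between neighbouring hyperbolas, including l = 4 N;
        any other remainder belongs to a hyperbola with index below \<open>N\<close>.\<close>
      have "F (4 * (l div 4) + l mod 4) \<noteq> {}"
      proof (cases "l mod 4 = 0")
        case True
        then show ?thesis using F_multiple[of "l div 4"] l by simp
      next
        case False
        moreover have "4 * (l div 4) + l mod 4 \<le> 4 * N" using l by simp
        ultimately have "l div 4 < N" by linarith
        then show ?thesis using F_inner[of "l div 4" "l mod 4"] False by simp
      qed
      then show ?thesis using l by simp
    next
      assume "l \<in> (+) (4 * N) ` X"
      then show ?thesis using F_last by (auto simp: X_def)
    qed
  qed
  moreover have "{..4 * N} \<inter> (+) (4 * N) ` X = {}"
    by (auto simp: X_def)
  ultimately have count: "card {l. l \<le> 4 * N + 4 \<and> F l \<noteq> {}} = k"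
    using \<open>card X = r\<close> k(1) by (simp add: card_Un_disjoint card_image X_def)

  define P where "P = ellipse_poly A * (\<Prod>i\<le>N. hyperbola_poly (a i) (p i) (q i))"
  note comps = components_ellipse_hyperbolas[of A N p q a, OF \<open>0 < A\<close> pq gap, folded P_def]
  have "total_degree P = 2 * nat \<lceil>real k / 4\<rceil> + 2"
    unfolding P_def ceil by (subst total_degree_ellipse_hyperbolas) simp_all
  moreover have "card (components (- imaginary_projection P)) = k"
    using comps(2) count unfolding F_def R_def E_def by simp
  ultimately show ?thesis
    using comps(1) by blast
qed

end
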